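(* Let $n\ge 1$ and let $f\in C^\infty(\mathbb{T}^n,\mathbb{R}^n)$. Let $\mathfrak{C}(f)\subset\mathbb{R}^n$ be the arithmetic cone of $f$. For every $\rho\in\mathfrak{C}(f)$ and every real $\lambda>0$, one has $\lambda\rho\in\mathfrak{C}(f)$. Thus $\mathfrak{C}(f)$ is a cone.
   Context: $\mathbb{T}^n=\mathbb{R}^n/\mathbb{Z}^n$; $\langle\cdot,\cdot\rangle$ is the Euclidean scalar product on $\mathbb{R}^n$; $\|\cdot\|$ is the Euclidean norm on $\mathbb{C}^n$. For $f\in C^\infty(\mathbb{T}^n,\mathbb{R}^n)$ the Fourier coefficients are $\hat f(p)=\int_{[0,1]^n}f(x)e^{-2\pi i\langle p,x\rangle}\,dx\in\mathbb{C}^n$ for $p\in\mathbb{Z}^n$, and the spectrum is $\operatorname{Spec}(f)=\{p\in\mathbb{Z}^n: \hat f(p)\neq 0\}$. The set of admissible rational vectors is $\mathbb{Q}^n_f=\{r\in\mathbb{Q}^n:\ \langle r,p\rangle\neq 0 \text{ for all } p\in\operatorname{Spec}(f)\setminus\{0\}\}$. For $r\in\mathbb{Q}^n_f$ the spectral gauge is $\Phi_f(r)=\sum_{p\in\operatorname{Spec}(f)\setminus\{0\}}\frac{\|\hat f(p)\|}{|\langle r,p\rangle|}$ (a convergent series). The arithmetic cone $\mathfrak{C}(f)$ is the set consisting of the zero vector $0$ (by convention) together with all $\rho\in\mathbb{R}^n\setminus\{0\}$ for which there exists a sequence $(r_k)_{k\in\mathbb{N}}\subset\mathbb{Q}^n_f$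 with $r_k\to\rho$ and $\sup_{k\in\mathbb{N}}\Phi_f(r_k)<\infty$. A cone means a subset of $\mathbb{R}^n$ closed under multiplication by every real $\lambda>0$. *)

theory Defs
  imports "HOL-Analysis.Analysis"
begin

definition integer_vectors :: "(real ^ 'n) set" where
  "integer_vectors = {p. \<forall>i. p $ i \<in> \<int>}"

definition rational_vectors :: "(real ^ 'n) set" where
  "rational_vectors = {r. \<forall>i. r $ i \<in> \<rat>}"

text \<open>Being \<open>k\<close> times continuously differentiable on the whole space: all iterated directional
  derivatives up to order \<open>k - 1\<close> are (Frechet) differentiable and those of order \<open>k\<close> are
  continuous.\<close>

primrec Ck_fun ::
  "nat \<Rightarrow> ('a::real_normed_vector \<Rightarrow> 'b::real_normed_vector) \<Rightarrow> bool" where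
  "Ck_fun 0 f \<longleftrightarrow> continuous_on UNIV f"
| "Ck_fun (Suc k) f \<longleftrightarrow>
     (\<forall>x. f differentiable (at x)) \<and> (\<forall>v. Ck_fun k (\<lambda>x. frechet_derivative f (at x) v))"

definition smooth_fun :: "('a::real_normed_vector \<Rightarrow> 'b::real_normed_vector) \<Rightarrow> bool" where
  "smooth_fun f \<longleftrightarrow> (\<forall>k. Ck_fun k f)"

text \<open>Functions on the torus \<open>\<real>\<^sup>n / \<int>\<^sup>n\<close> are represented by their \<open>\<int>\<^sup>n\<close>-periodic lifts to \<open>\<real>\<^sup>n\<close>.\<close>

definition smooth_on_torus :: "(real ^ 'n \<Rightarrow> real ^ 'm) \<Rightarrow> bool" where
  "smooth_on_torus f \<longleftrightarrow>
     smooth_fun f \<and> (\<forall>x. \<forall>p \<in> integer_vectors. f (x + p) = f x)"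

text \<open>Here \<open>cbox 0 1\<close> is the unit cube: \<open>1\<close> is the vector all of whose entries are \<open>1\<close>.\<close>

definition fourier_coeff :: "(real ^ 'n \<Rightarrow> real ^ 'm) \<Rightarrow> real ^ 'n \<Rightarrow> complex ^ 'm" where
  "fourier_coeff f p =
     integral (cbox 0 1)
       (\<lambda>x. \<chi> j. complex_of_real (f x $ j) *
                 exp (- (2 * complex_of_real pi * \<i> * complex_of_real (p \<bullet> x))))"

definition spectrum :: "(real ^ 'n \<Rightarrow> real ^ 'm) \<Rightarrow> (real ^ 'n) set" where
  "spectrum f = {p \<in> integer_vectors. fourier_coeff f p \<noteq> 0}"

definition admissible :: "(real ^ 'n \<Rightarrow> real ^ 'm) \<Rightarrow> (real ^ 'n) set" where
  "admissible f = {r \<in> rational_vectors. \<forall>p \<in> spectrum f - {0}. r \<bullet> p \<noteq> 0}"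

text \<open>The series has nonnegative terms and is summed in \<open>[0, \<infinity>]\<close>, so that no value has to be
  chosen for a divergent series; for smooth \<open>f\<close> and admissible \<open>r\<close> the sum is finite. The type
  \<^typ>\<open>ennreal\<close> also makes the boundedness condition below literally \<open>sup < \<infinity>\<close>.\<close>

definition spectral_gauge :: "(real ^ 'n \<Rightarrow> real ^ 'm) \<Rightarrow> real ^ 'n \<Rightarrow> ennreal" where
  "spectral_gauge f r =
     (\<Sum>\<^sub>\<infinity>p \<in> spectrum f - {0}. ennreal (norm (fourier_coeff f p) / \<bar>r \<bullet> p\<bar>))"

definition arithmetic_cone :: "(real ^ 'n \<Rightarrow> real ^ 'm) \<Rightarrow> (real ^ 'n) set" where
  "arithmetic_cone f =
     {0} \<union> {\<rho>. \<rho> \<noteq> 0 \<and>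
            (\<exists>r :: nat \<Rightarrow> real ^ 'n.
               (\<forall>k. r k \<in> admissible f) \<and> r \<longlonglongrightarrow> \<rho> \<and>
               (SUP k. spectral_gauge f (r k)) < \<infinity>)}"

text \<open>Unlike the library's \<^const>\<open>cone\<close>, only positive factors are used.\<close>

definition positive_cone :: "'a::real_vector set \<Rightarrow> bool" where
  "positive_cone S \<longleftrightarrow> (\<forall>x \<in> S. \<forall>c > 0. c *\<^sub>R x \<in> S)"

end

theory Submission
  imports Defs
begin

text \<open>
  The gauge is homogeneous of degree \<open>-1\<close> and admissibility is invariant under nonzero rational
  factors, so for a rational factor one could simply rescale the approximating sequence. A real
  factor \<open>c\<close> would destroy the rationality of the approximants. The remedy is to scale the
  \<open>k\<close>-th approximant by its own rational factor \<open>q k\<close>, where \<open>q k\<close> tends to \<open>c\<close> from above: the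
  scaled sequence then tends to \<open>c *\<^sub>R \<rho>\<close>, and its gauges grow at most by the constant factor
  \<open>1 / c\<close>.
\<close>

lemma admissible_scaleR_rational:
  assumes "r \<in> admissible f" "q \<in> \<rat>" "q \<noteq> 0"
  shows "q *\<^sub>R r \<in> admissible f"
  using assms by (auto simp: admissible_def rational_vectors_def)

text \<open>
  Multiplication on \<^typ>\<open>ennreal\<close> is not jointly continuous at \<open>(0, \<infinity>)\<close>, so this is not an
  instance of \<open>infsum_cmult_right\<close>. Multiplication by a fixed finite factor is continuous, and that is
  enough to pass to the limit of the finite partial sums.
\<close>

lemma infsum_cmult_right_ennreal:
  fixes g :: "'a \<Rightarrow> ennreal"
  assumes "c < \<infinity>"
  shows "(\<Sum>\<^sub>\<infinity>x\<in>A. c * g x) = c * (\<Sum>\<^sub>\<infinity>x\<in>A. g x)"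
proof (rule infsumI)
  have "(sum g \<longlongrightarrow> infsum g A) (finite_subsets_at_top A)"
    using has_sum_infsum[OF nonneg_summable_on_complete, of A g] by (simp add: has_sum_def)
  then have "((\<lambda>F. c * sum g F) \<longlongrightarrow> c * infsum g A) (finite_subsets_at_top A)"
    using assms by (intro ennreal_tendsto_cmult) auto
  then show "((\<lambda>x. c * g x) has_sum c * infsum g A) A"
    by (simp add: has_sum_def sum_distrib_left)
qed

lemma spectral_gauge_scaleR:
  assumes "q > 0"
  shows "spectral_gauge f (q *\<^sub>R r) = ennreal (1 / q) * spectral_gauge f r"
proof -
  have "ennreal (norm (fourier_coeff f p) / \<bar>q *\<^sub>R r \<bullet> p\<bar>)
      = ennreal (1 / q) * ennreal (norm (fourier_coeff f p) / \<bar>r \<bullet> p\<bar>)" for p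
    using assms by (simp add: abs_mult flip: ennreal_mult)
  then show ?thesis
    by (simp add: spectral_gauge_def infsum_cmult_right_ennreal)
qed

lemma ex_rational_seq_from_above:
  fixes c :: real
  obtains q :: "nat \<Rightarrow> real" where "\<And>k. q k \<in> \<rat>" "\<And>k. c < q k" "q \<longlonglongrightarrow> c"
proof -
  have "\<exists>q. \<forall>k. q k \<in> \<rat> \<and> c < q k \<and> q k < c + 1 / real (Suc k)"
  proof (rule choice, rule allI)
    fix k
    show "\<exists>q. q \<in> \<rat> \<and> c < q \<and> q < c + 1 / real (Suc k)"
      using Rats_dense_in_real[of c "c + 1 / real (Suc k)"] by auto
  qed
  then obtain q where q: "\<And>k. q k \<in> \<rat>" "\<And>k. c < q k" "\<And>k. q k < c + 1 / real (Suc k)"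
    by blast
  have "q \<longlonglongrightarrow> c"
  proof (rule tendsto_sandwich[OF _ _ tendsto_const])
    show "(\<lambda>k. c + 1 / real (Suc k)) \<longlonglongrightarrow> c"
      using LIMSEQ_inverse_real_of_nat_add[of c] by (simp add: inverse_eq_divide)
  qed (use q in \<open>auto intro!: always_eventually less_imp_le\<close>)
  with q that show ?thesis by blast
qed

text \<open>
  Approaching \<open>c\<close> from above, rather than merely through positive rationals, makes the single bound
  \<open>1 / q k \<le> 1 / c\<close> available for all \<open>k\<close>.
\<close>

lemma arithmetic_cone_scaleR:
  assumes \<rho>: "\<rho> \<in> arithmetic_cone f" and c: "c > 0"
  shows "c *\<^sub>R \<rho> \<in> arithmetic_cone f"
proof (cases "\<rho> = 0")
  case True
  then show ?thesis by (simp add: arithmetic_cone_def)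
next
  case False
  with \<rho> obtain r where adm: "\<And>k. r k \<in> admissible f" and lim: "r \<longlonglongrightarrow> \<rho>"
    and bdd: "(SUP k. spectral_gauge f (r k)) < \<infinity>"
    unfolding arithmetic_cone_def by blast
  obtain q where q_rat: "\<And>k. q k \<in> \<rat>" and q_gt: "\<And>k. c < q k" and q_lim: "q \<longlonglongrightarrow> c"
    using ex_rational_seq_from_above[of c] by blast
  have q_pos: "0 < q k" for k
    using c q_gt[of k] by simp
  have "(SUP k. spectral_gauge f (q k *\<^sub>R r k)) \<le> ennreal (1 / c) * (SUP k. spectral_gauge f (r k))"
  proof (rule SUP_least)
    fix k
    have "1 / q k \<le> 1 / c"
      using c q_gt[of k] by (intro divide_left_mono) auto
    then show "spectral_gauge f (q k *\<^sub>R r k) \<le> ennreal (1 / c) * (SUP k. spectral_gauge f (r k))"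
      by (simp only: spectral_gauge_scaleR[OF q_pos])
        (intro mult_mono ennreal_leI SUP_upper; simp)
  qed
  also have "\<dots> < \<infinity>"
    using bdd by (simp add: ennreal_mult_less_top)
  finally have "(SUP k. spectral_gauge f (q k *\<^sub>R r k)) < \<infinity>" .
  moreover have "q k *\<^sub>R r k \<in> admissible f" for k
    using admissible_scaleR_rational[OF adm q_rat] q_pos[of k] by simp
  moreover have "(\<lambda>k. q k *\<^sub>R r k) \<longlonglongrightarrow> c *\<^sub>R \<rho>"
    by (intro tendsto_scaleR q_lim lim)
  moreover have "c *\<^sub>R \<rho> \<noteq> 0"
    using c False by simp
  ultimately show ?thesis
    unfolding arithmetic_cone_def by (intro UnI2 CollectI conjI exI[of _ "\<lambda>k. q k *\<^sub>R r k"]) auto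
qed

theorem proposition6p3:
  fixes f :: "real ^ 'n \<Rightarrow> real ^ 'n"
  assumes "smooth_on_torus f"
  shows "(\<forall>\<rho> \<in> arithmetic_cone f. \<forall>c::real. c > 0 \<longrightarrow> c *\<^sub>R \<rho> \<in> arithmetic_cone f)
         \<and> positive_cone (arithmetic_cone f)"
  by (auto simp: positive_cone_def arithmetic_cone_scaleR)

end
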